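(* Let $N\ge 2$ be an integer, let $p>1$, and assume $p<\frac{N+2}{N-2}$ if $N\ge 3$. Let $a:\mathbb{R}^N\to\mathbb{R}$ satisfy $a\in L^{N/2}_{\mathrm{loc}}(\mathbb{R}^N)$, $\inf_{\mathbb{R}^N}a>0$, $\lim_{|x|\to\infty}a(x)=a_\infty\in\mathbb{R}$, $\lim_{|x|\to\infty}[a(x)-a_\infty]e^{\eta|x|}=\infty$ for every $\eta>0$, and, for some $\tilde\eta>0$, $$\lim_{\rho\to\infty}\sup\{a(\rho\theta_1)-a(\rho\theta_2): \theta_1,\theta_2\in\mathbb{R}^N,\ |\theta_1|=|\theta_2|=1\}\,e^{\tilde\eta\rho}=0.$$ For every $\sigma>0$ and every integer $k\ge2$ let $r_k>0$ and $(x_1^k,\ldots,x_k^k)\in D_k$ (depending also on $\sigma$) satisfy $$\Big[\frac1k\sum_{i=1}^k|x_i^k|^2\Big]^{1/2}=r_k,\qquad (1+2\sigma)^{-1}r_k\le|x_i^k|\le(1+2\sigma)r_k\ \text{ for }i=1,\ldots,k,$$ $$f_k(x_1^k,\ldots,x_k^k)=g^{k,\sigma}\Big(r_k,\frac{x_1^k}{|x_1^k|},\ldots,\frac{x_k^k}{|x_k^k|}\Big)=\max_{D^{k,\sigma}}g^{k,\sigma},$$ and set $$\Gamma_k=\min\Big\{\Big|\frac{x_i^k}{|x_i^k|}-\frac{x_j^k}{|x_j^k|}\Big|: i,j\in\{1,\ldots,k\},\ i\ne j\Big\},\qquad \Lambda_k=\max_{\theta\in S(0,1)}\min\Big\{\Big|\theta-\frac{x_i^k}{|x_i^k|}\Big|: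 i=1,\ldots,k\Big\}.$$ Let $\tilde\sigma>0$ be such that $\limsup_{k\to\infty}\Lambda_k/\Gamma_k<\infty$ for all $\sigma\in\,]0,\tilde\sigma[$ (such a $\tilde\sigma$ exists), and let $\sigma\in\,]0,\tilde\sigma[$. Then $$\lim_{k\to\infty}\Lambda_k=0.$$ Moreover, if for all $x\in S(0,1)$ and $r>0$ we denote by $N_k(x,r)$ the number of elements of the set $\big\{x_i^k: i\in\{1,\ldots,k\},\ \frac{x_i^k}{|x_i^k|}\in B(x,r)\big\}$, then there exists $c>0$ such that $$\liminf_{\varepsilon\to0}\ \liminf_{k\to\infty}\frac{N_k(x,\varepsilon)}{k\,\varepsilon^{N-1}}\ge c\qquad\forall x\in S(0,1).$$
   Context: $B(z,\rho)$ is the ball of radius $\rho$ centered at $z$ and $S(z,\rho)=\partial B(z,\rho)$. Set $a_0=\inf_{\mathbb{R}^N}a$. The energy functional is $$E(u)=\frac12\int_{\mathbb{R}^N}(|\nabla u|^2+a(x)u^2)\,dx-\frac1{p+1}\int_{\mathbb{R}^N}|u|^{p+1}\,dx,\qquad u\in H^1(\mathbb{R}^N),$$ and $E'(u)[v]=\int_{\mathbb{R}^N}(\nabla u\cdot\nabla v+a(x)uv-|u|^{p-1}uv)\,dx$. $w$ is the positive ground state solution of $-\Delta u+a_\infty u=|u|^{p-1}u$, $u\in H^1(\mathbb{R}^N)$, unique up to translations, taken radially symmetric about the origin and radially decreasing. A number $\delta>0$ is fixed with $\delta<\min\{1,(a_0/p)^{1/(p-1)},(a_0/2)^{1/(p-1)},\tfrac12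 a_0^{1/(p-1)},w(0)/3\}$, and $R_\delta>0$ is fixed so that $w(x)<\delta$ for all $x\in\mathbb{R}^N\setminus B(0,R_\delta/2)$. For $u\in H^1(\mathbb{R}^N)$, $u\ge0$, put $u_\delta=\min(u,\delta)$ and $u^\delta=u-u_\delta$. Such a $u$ is emerging around $x_1,\ldots,x_k\in\mathbb{R}^N$ if $u^\delta=\sum_{i=1}^k u_i^\delta$ where, for each $i$, $u_i^\delta(x)=0$ for all $x\notin B(x_i,R_\delta)$ and $u_i^\delta\not\equiv0$. For $k\ge2$, $D_k=\{(x_1,\ldots,x_k)\in(\mathbb{R}^N)^k: |x_i-x_j|\ge 3R_\delta\text{ for }i\ne j\}$. For $(x_1,\ldots,x_k)\in D_k$, $S_{x_1,\ldots,x_k}$ is the set of $u\in H^1(\mathbb{R}^N)$, $u\ge0$, emerging around $x_1,\ldots,x_k$ and such that, for every $i\in\{1,\ldots,k\}$, $E'(u)[u_i^\delta]=0$ and $\beta_i(u)=x_i$, where $\beta_i(u)=\big(\int_{\mathbb{R}^N}(u_i^\delta)^2dx\big)^{-1}\int_{\mathbb{R}^N}x\,(u_i^\delta(x))^2\,dx$. Put $f_k(x_1,\ldots,x_k)=\inf\{E(u): u\in S_{x_1,\ldots,x_k}\}$ (the infimum is attained, and $f_k$ is continuous on $D_k$). For $\sigma>0$, $k\ge2$, $\rho\ge0$ and $(\theta_1,\ldots,\theta_k)\in[S(0,1)]^k$, $D^{k,\sigma}(\rho,\theta_1,\ldots,\theta_k)$ is the set of $(x_1,\ldots,x_k)\in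 D_k$ with $\big[\frac1k\sum_{i=1}^k|x_i|^2\big]^{1/2}=\rho$, $(1+2\sigma)^{-1}\rho\le|x_i|\le(1+2\sigma)\rho$ and $\frac{x_i}{|x_i|}=\theta_i$ for $i=1,\ldots,k$. $D^{k,\sigma}$ is the set of $(\rho,\theta_1,\ldots,\theta_k)$ with $\rho\ge0$, $\theta_i\in S(0,1)$ and $D^{k,\sigma}(\rho,\theta_1,\ldots,\theta_k)\ne\emptyset$, and $g^{k,\sigma}:D^{k,\sigma}\to\mathbb{R}$ is $$g^{k,\sigma}(\rho,\theta_1,\ldots,\theta_k)=\min\{f_k(x_1,\ldots,x_k): (x_1,\ldots,x_k)\in D^{k,\sigma}(\rho,\theta_1,\ldots,\theta_k)\}.$$ Numbers $r_k$ and points $(x_1^k,\ldots,x_k^k)$ with the properties assumed in the claim exist for all $\sigma>0$, $k\ge2$. *)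

theory Defs
  imports "HOL-Analysis.Analysis"
begin

text \<open>
  Elements of L^2 and H^1 are represented by functions, not by classes modulo null sets.
  Accordingly every relation between such functions is imposed almost everywhere.
\<close>

primrec C_n :: "nat \<Rightarrow> ('a::euclidean_space \<Rightarrow> real) \<Rightarrow> bool" where
  "C_n 0 f \<longleftrightarrow> continuous_on UNIV f"
| "C_n (Suc n) f \<longleftrightarrow> (\<forall>x. f differentiable (at x)) \<and>
     (\<forall>b\<in>Basis. C_n n (\<lambda>x. frechet_derivative f (at x) b))"

definition test_function :: "('a::euclidean_space \<Rightarrow> real) \<Rightarrow> bool" where
  "test_function \<phi> \<longleftrightarrow> (\<forall>n. C_n n \<phi>) \<and> compact (closure {x. \<phi> x \<noteq> 0})"

definition L2 :: "('a::euclidean_space \<Rightarrow> 'b::euclidean_space) set" where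
  "L2 = {f. f \<in> borel_measurable lebesgue \<and> integrable lebesgue (\<lambda>x. (norm (f x))\<^sup>2)}"

definition is_weak_gradient ::
    "('a::euclidean_space \<Rightarrow> real) \<Rightarrow> ('a \<Rightarrow> 'a) \<Rightarrow> bool" where
  "is_weak_gradient u g \<longleftrightarrow>
     (\<forall>\<phi>. test_function \<phi> \<longrightarrow> (\<forall>b\<in>Basis.
        (LINT x|lebesgue. u x * frechet_derivative \<phi> (at x) b)
          = - (LINT x|lebesgue. (g x \<bullet> b) * \<phi> x)))"

definition H1 :: "('a::euclidean_space \<Rightarrow> real) set" where
  "H1 = {u \<in> L2. \<exists>g\<in>L2. is_weak_gradient u g}"

text \<open>For u in H^1 the weak gradient is unique up to null sets; we choose a representative.\<close>

definition grad :: "('a::euclidean_space \<Rightarrow> real) \<Rightarrow> 'a \<Rightarrow> 'a" where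
  "grad u = (SOME g. g \<in> L2 \<and> is_weak_gradient u g)"

definition Lp_loc :: "real \<Rightarrow> ('a::euclidean_space \<Rightarrow> real) set" where
  "Lp_loc q = {f. f \<in> borel_measurable lebesgue \<and>
     (\<forall>K. compact K \<longrightarrow> set_integrable lebesgue K (\<lambda>x. \<bar>f x\<bar> powr q))}"

definition energy ::
    "('a::euclidean_space \<Rightarrow> real) \<Rightarrow> real \<Rightarrow> ('a \<Rightarrow> real) \<Rightarrow> real" where
  "energy a p u =
     1/2 * (LINT x|lebesgue. (norm (grad u x))\<^sup>2 + a x * (u x)\<^sup>2)
     - 1/(p+1) * (LINT x|lebesgue. \<bar>u x\<bar> powr (p+1))"

definition energy_deriv ::
    "('a::euclidean_space \<Rightarrow> real) \<Rightarrow> real \<Rightarrow> ('a \<Rightarrow> real) \<Rightarrow> ('a \<Rightarrow> real) \<Rightarrow> real" where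
  "energy_deriv a p u v =
     (LINT x|lebesgue. grad u x \<bullet> grad v x + a x * u x * v x - \<bar>u x\<bar> powr (p-1) * u x * v x)"

definition nontrivial_solution ::
    "real \<Rightarrow> real \<Rightarrow> ('a::euclidean_space \<Rightarrow> real) \<Rightarrow> bool" where
  "nontrivial_solution a_inf p u \<longleftrightarrow>
     u \<in> H1 \<and> \<not> (AE x in lebesgue. u x = 0) \<and>
     (\<forall>v\<in>H1. energy_deriv (\<lambda>_. a_inf) p u v = 0)"

text \<open>
  A ground state is a nontrivial (weak) solution of least energy. Since pointwise values of w
  are used, w is the continuous representative.
\<close>

definition radial_ground_state ::
    "real \<Rightarrow> real \<Rightarrow> ('a::euclidean_space \<Rightarrow> real) \<Rightarrow> bool" where
  "radial_ground_state a_inf p w \<longleftrightarrow>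
     nontrivial_solution a_inf p w \<and>
     (\<forall>u :: 'a \<Rightarrow> real. nontrivial_solution a_inf p u
        \<longrightarrow> energy (\<lambda>_. a_inf) p w \<le> energy (\<lambda>_. a_inf) p u) \<and>
     continuous_on UNIV w \<and> (\<forall>x. w x > 0) \<and>
     (\<forall>x y. norm x = norm y \<longrightarrow> w x = w y) \<and>
     (\<forall>x y. norm x < norm y \<longrightarrow> w y < w x)"

definition excess :: "real \<Rightarrow> ('a \<Rightarrow> real) \<Rightarrow> 'a \<Rightarrow> real" where
  "excess \<delta> u = (\<lambda>x. u x - min (u x) \<delta>)"

text \<open>
  A k-tuple is a function on the natural numbers of which only the values
  at 1, ..., k matter.

  The predicate says that u is emerging around x 1, ..., x k and that the functions v i are the
  corresponding pieces of its excess over delta. If the points are at mutual distance at least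
  3 R, the pieces are determined by u up to null sets.
\<close>

definition emerging_with ::
    "real \<Rightarrow> real \<Rightarrow> nat \<Rightarrow> (nat \<Rightarrow> 'a::euclidean_space) \<Rightarrow> ('a \<Rightarrow> real)
      \<Rightarrow> (nat \<Rightarrow> 'a \<Rightarrow> real) \<Rightarrow> bool" where
  "emerging_with \<delta> R k x u v \<longleftrightarrow>
     (AE y in lebesgue. excess \<delta> u y = (\<Sum>i=1..k. v i y)) \<and>
     (\<forall>i\<in>{1..k}. (AE y in lebesgue. y \<notin> ball (x i) R \<longrightarrow> v i y = 0) \<and>
                  \<not> (AE y in lebesgue. v i y = 0))"

definition D_conf :: "real \<Rightarrow> nat \<Rightarrow> (nat \<Rightarrow> 'a::euclidean_space) set" where
  "D_conf R k = {x. \<forall>i\<in>{1..k}. \<forall>j\<in>{1..k}. i \<noteq> j \<longrightarrow> norm (x i - x j) \<ge> 3 * R}"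

definition barycenter :: "('a::euclidean_space \<Rightarrow> real) \<Rightarrow> 'a" where
  "barycenter v =
     inverse (LINT y|lebesgue. (v y)\<^sup>2) *\<^sub>R (LINT y|lebesgue. (v y)\<^sup>2 *\<^sub>R y)"

text \<open>
  In dimension 2, with a only locally integrable, the integral of a * u^2 may be infinite for
  some u in H^1 (whereas the library's integral of a non-integrable function is 0); the
  integrability condition keeps exactly the u of finite energy, and is automatic in dimension
  at least 3. It excludes no u for which the integrals in E'(u)[v i] all converge.
\<close>

definition S_conf ::
    "('a::euclidean_space \<Rightarrow> real) \<Rightarrow> real \<Rightarrow> real \<Rightarrow> real \<Rightarrow> nat \<Rightarrow> (nat \<Rightarrow> 'a)
      \<Rightarrow> ('a \<Rightarrow> real) set" where
  "S_conf a p \<delta> R k x =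
     {u \<in> H1. (AE y in lebesgue. 0 \<le> u y) \<and>
        integrable lebesgue (\<lambda>y. a y * (u y)\<^sup>2) \<and>
        (\<exists>v. emerging_with \<delta> R k x u v \<and>
          (\<forall>i\<in>{1..k}. energy_deriv a p u (v i) = 0 \<and> barycenter (v i) = x i))}"

definition f_conf ::
    "('a::euclidean_space \<Rightarrow> real) \<Rightarrow> real \<Rightarrow> real \<Rightarrow> real \<Rightarrow> nat \<Rightarrow> (nat \<Rightarrow> 'a) \<Rightarrow> real" where
  "f_conf a p \<delta> R k x = (INF u\<in>S_conf a p \<delta> R k x. energy a p u)"

text \<open>
  The direction of x is written sgn x. It equals x / |x| for nonzero x; since sgn 0 = 0 has not
  norm 1, tuples with some x i = 0 belong to no slice with directions on the unit sphere.
\<close>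

definition quad_mean :: "nat \<Rightarrow> (nat \<Rightarrow> 'a::euclidean_space) \<Rightarrow> real" where
  "quad_mean k x = sqrt (1 / real k * (\<Sum>i=1..k. (norm (x i))\<^sup>2))"

definition D_slice ::
    "real \<Rightarrow> nat \<Rightarrow> real \<Rightarrow> real \<Rightarrow> (nat \<Rightarrow> 'a::euclidean_space) \<Rightarrow> (nat \<Rightarrow> 'a) set" where
  "D_slice R k \<sigma> \<rho> \<theta> =
     {x \<in> D_conf R k. quad_mean k x = \<rho> \<and>
        (\<forall>i\<in>{1..k}. inverse (1 + 2*\<sigma>) * \<rho> \<le> norm (x i) \<and> norm (x i) \<le> (1 + 2*\<sigma>) * \<rho> \<and>
                     sgn (x i) = \<theta> i)}"

definition D_param :: "real \<Rightarrow> nat \<Rightarrow> real \<Rightarrow> (real \<times> (nat \<Rightarrow> 'a::euclidean_space)) set" where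
  "D_param R k \<sigma> =
     {(\<rho>, \<theta>). \<rho> \<ge> 0 \<and> (\<forall>i\<in>{1..k}. \<theta> i \<in> sphere 0 1) \<and> D_slice R k \<sigma> \<rho> \<theta> \<noteq> {}}"

text \<open>The infimum is a minimum: the slices are compact and f is continuous on them.\<close>

definition g_conf ::
    "('a::euclidean_space \<Rightarrow> real) \<Rightarrow> real \<Rightarrow> real \<Rightarrow> real \<Rightarrow> nat \<Rightarrow> real
      \<Rightarrow> real \<Rightarrow> (nat \<Rightarrow> 'a) \<Rightarrow> real" where
  "g_conf a p \<delta> R k \<sigma> \<rho> \<theta> = (INF x\<in>D_slice R k \<sigma> \<rho> \<theta>. f_conf a p \<delta> R k x)"

definition max_conf ::
    "('a::euclidean_space \<Rightarrow> real) \<Rightarrow> real \<Rightarrow> real \<Rightarrow> real \<Rightarrow> nat \<Rightarrow> real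
      \<Rightarrow> real \<Rightarrow> (nat \<Rightarrow> 'a) \<Rightarrow> bool" where
  "max_conf a p \<delta> R k \<sigma> r x \<longleftrightarrow>
     r > 0 \<and> x \<in> D_conf R k \<and> quad_mean k x = r \<and>
     (\<forall>i\<in>{1..k}. inverse (1 + 2*\<sigma>) * r \<le> norm (x i) \<and> norm (x i) \<le> (1 + 2*\<sigma>) * r) \<and>
     f_conf a p \<delta> R k x = g_conf a p \<delta> R k \<sigma> r (\<lambda>i. sgn (x i)) \<and>
     (r, \<lambda>i. sgn (x i)) \<in> D_param R k \<sigma> \<and>
     (\<forall>(\<rho>, \<theta>)\<in>D_param R k \<sigma>. g_conf a p \<delta> R k \<sigma> \<rho> \<theta> \<le> g_conf a p \<delta> R k \<sigma> r (\<lambda>i. sgn (x i)))"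

definition Gamma_min :: "nat \<Rightarrow> (nat \<Rightarrow> 'a::euclidean_space) \<Rightarrow> real" where
  "Gamma_min k x =
     Min {norm (sgn (x i) - sgn (x j)) |i j. i \<in> {1..k} \<and> j \<in> {1..k} \<and> i \<noteq> j}"

text \<open>The supremum is a maximum, by compactness of the sphere.\<close>

definition Lambda_max :: "nat \<Rightarrow> (nat \<Rightarrow> 'a::euclidean_space) \<Rightarrow> real" where
  "Lambda_max k x = (SUP \<theta>\<in>sphere 0 1. Min {norm (\<theta> - sgn (x i)) |i. i \<in> {1..k}})"

definition N_count :: "nat \<Rightarrow> (nat \<Rightarrow> 'a::euclidean_space) \<Rightarrow> 'a \<Rightarrow> real \<Rightarrow> nat" where
  "N_count k x \<xi> \<epsilon> = card {x i |i. i \<in> {1..k} \<and> sgn (x i) \<in> ball \<xi> \<epsilon>}"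

end

theory Submission
  imports Defs
begin

text \<open>
  The hypothesis gives a constant \<open>C\<close> with \<open>\<Lambda> \<le> C \<Gamma>\<close> for large \<open>k\<close>. The \<open>k\<close> directions are
  \<open>\<Gamma>\<close>-separated on an \<open>(N-1)\<close>-dimensional sphere, hence \<open>k \<Gamma>^(N-1)\<close> is bounded, so \<open>\<Gamma>\<close> and with it
  \<open>\<Lambda>\<close> tends to 0. Conversely the directions form a \<open>\<Lambda>\<close>-net, so a cap of radius \<open>\<epsilon>\<close> contains at
  least a constant times \<open>(\<epsilon> / \<Lambda>)^(N-1)\<close> of them, which is at least a constant times
  \<open>k \<epsilon>^(N-1) (\<Gamma> / \<Lambda>)^(N-1)\<close>.
\<close>

section \<open>Packing and covering on the unit sphere by volume comparison\<close>

text \<open>Factoring out \<open>2 * h\<close> leaves a sum of \<open>n\<close> products, each at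
  most \<open>2 ^ (n - 1)\<close>. The factor \<open>h\<close> says that a thin spherical shell has
  volume of the order of its thickness, which lowers the packing exponent by one.\<close>

lemma power_diff_symmetric_le:
  fixes h :: real
  assumes "0 \<le> h" "h \<le> 1"
  shows "(1 + h) ^ n - (1 - h) ^ n \<le> real n * h * 2 ^ n"
proof (cases n)
  case (Suc m)
  have "(1 + h) ^ n - (1 - h) ^ n = 2 * h * (\<Sum>i<n. (1 - h) ^ (n - Suc i) * (1 + h) ^ i)"
    using power_diff_sumr2[of "1 + h" n "1 - h"] by simp
  also have "(\<Sum>i<n. (1 - h) ^ (n - Suc i) * (1 + h) ^ i) \<le> (\<Sum>i<n. 1 * 2 ^ m)"
  proof (rule sum_mono, rule mult_mono)
    fix i assume "i \<in> {..<n}"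
    then have "i \<le> m" using Suc by auto
    have "(1 + h) ^ i \<le> 2 ^ i" using assms by (intro power_mono) auto
    also have "\<dots> \<le> 2 ^ m" using \<open>i \<le> m\<close> by (intro power_increasing) auto
    finally show "(1 + h) ^ i \<le> 2 ^ m" .
  qed (use assms in \<open>auto intro: power_le_one\<close>)
  then have "2 * h * (\<Sum>i<n. (1 - h) ^ (n - Suc i) * (1 + h) ^ i) \<le> 2 * h * (\<Sum>i<n. 1 * 2 ^ m)"
    using assms by (intro mult_left_mono) auto
  also have "\<dots> = real n * h * 2 ^ n" using Suc by simp
  finally show ?thesis .
qed simp

text \<open>Balls of radius \<open>d / 2\<close> about the points are disjoint and lie in a
  spherical shell of thickness \<open>d\<close>. Each has volume of order \<open>d ^ DIM('a)\<close>
  and the shell has volume of order \<open>d\<close>, so one factor \<open>d\<close>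
  cancels.\<close>

lemma card_separated_sphere_le:
  fixes T :: "'a::euclidean_space set"
  assumes T: "finite T" "T \<subseteq> sphere 0 1"
    and d: "0 < d" "d \<le> 2"
    and sep: "\<And>s t. s \<in> T \<Longrightarrow> t \<in> T \<Longrightarrow> s \<noteq> t \<Longrightarrow> d \<le> dist s t"
  shows "real (card T) * d ^ (DIM('a) - 1) \<le> real DIM('a) * 4 ^ DIM('a)"
proof -
  define N where "N = DIM('a)"
  define V where "V = unit_ball_vol (real N)"
  define h where "h = d / 2"
  have V: "V > 0" unfolding V_def by (rule unit_ball_vol_pos) simp
  have h: "0 < h" "h \<le> 1" using d by (auto simp: h_def)
  have pow: "y ^ N = y * y ^ (N - 1)" for y :: real
    by (subst power_eq_if) (simp add: N_def)
  have sub: "(\<Union>t\<in>T. ball t h) \<subseteq> ball 0 (1 + h) - ball 0 (1 - h)"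
  proof
    fix y assume "y \<in> (\<Union>t\<in>T. ball t h)"
    then obtain t where t: "t \<in> T" "dist t y < h" by auto
    then have "norm t = 1" using T by auto
    moreover have "\<bar>norm t - norm y\<bar> \<le> dist t y"
      unfolding dist_norm by (rule norm_triangle_ineq3)
    ultimately show "y \<in> ball 0 (1 + h) - ball 0 (1 - h)" using t(2) by auto
  qed
  have "real (card T) * (V * h ^ N) = (\<Sum>t\<in>T. measure lebesgue (ball t h))"
    using h by (simp add: content_ball V_def N_def)
  also have "\<dots> = measure lebesgue (\<Union>t\<in>T. ball t h)"
  proof (rule measure_UNION'[symmetric])
    show "pairwise (\<lambda>s t. disjnt (ball s h) (ball t h)) T"
      using sep unfolding pairwise_def disjnt_def
      by (auto intro!: disjoint_ballI simp: h_def simp del: dist_norm)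
  qed (use T in auto)
  also have "\<dots> \<le> measure lebesgue (ball 0 (1 + h) - ball (0::'a) (1 - h))"
    using T by (intro measure_mono_fmeasurable[OF sub]) (auto intro!: fmeasurable.Diff)
  also have "\<dots> = V * ((1 + h) ^ N - (1 - h) ^ N)"
    using h by (subst measurable_measure_Diff)
      (auto simp: content_ball V_def N_def algebra_simps intro!: subset_ball)
  also have "\<dots> \<le> V * (real N * h * 2 ^ N)"
    using V h by (intro mult_left_mono power_diff_symmetric_le) auto
  finally have "V * h * (real (card T) * h ^ (N - 1)) \<le> V * h * (real N * 2 ^ N)"
    by (simp only: pow[of h] mult_ac)
  then have *: "real (card T) * h ^ (N - 1) \<le> real N * 2 ^ N" using V h by simp
  have "real (card T) * d ^ (N - 1) = 2 ^ (N - 1) * (real (card T) * h ^ (N - 1))"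
    by (simp add: h_def power_divide)
  also have "\<dots> \<le> 2 ^ N * (real N * 2 ^ N)"
    by (rule mult_mono[OF power_increasing *]) (use h in auto)
  also have "\<dots> = real N * 4 ^ N" by (simp flip: power_mult_distrib)
  finally show ?thesis by (simp add: N_def)
qed

text \<open>
  Homothetic copies of the net on the concentric spheres of radius \<open>1 - \<rho> + j L\<close>
  form a net of a full-dimensional ball, so that Lebesgue measure can replace surface measure.
\<close>

lemma card_net_cap_ge:
  fixes T :: "'a::euclidean_space set"
  assumes T: "finite T" "T \<subseteq> sphere 0 1"
    and net: "\<And>\<theta>. \<theta> \<in> sphere 0 1 \<Longrightarrow> \<exists>t\<in>T. dist \<theta> t \<le> L"
    and L: "0 < L" "L \<le> \<rho>" and \<rho>: "\<rho> < 1" and \<xi>: "\<xi> \<in> sphere 0 1"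
  shows "\<rho> ^ (DIM('a) - 1)
    \<le> 3 ^ (DIM('a) + 1) * real (card (T \<inter> ball \<xi> (4 * \<rho>))) * L ^ (DIM('a) - 1)"
proof -
  define N where "N = DIM('a)"
  define V where "V = unit_ball_vol (real N)"
  have V: "V > 0" unfolding V_def by (rule unit_ball_vol_pos) simp
  have pow: "y ^ N = y * y ^ (N - 1)" for y :: real
    by (subst power_eq_if) (simp add: N_def)
  define A where "A = T \<inter> ball \<xi> (4 * \<rho>)"
  \<comment> \<open>Norms of points of \<open>ball \<xi> \<rho>\<close> fill an interval of length
    at most \<open>2 * \<rho>\<close> above \<open>1 - \<rho>\<close>, so the radii
    \<open>q 0, ..., q J\<close> in steps of \<open>L\<close> suffice.\<close>
  define J where "J = nat \<lfloor>2 * \<rho> / L\<rfloor>"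
  define q where "q = (\<lambda>j. 1 - \<rho> + real j * L)"
  have fin: "finite (A \<times> {..J})" using T by (simp add: A_def)
  have cover: "ball \<xi> \<rho> \<subseteq> (\<Union>(t, j)\<in>A \<times> {..J}. cball (q j *\<^sub>R t) (3 * L))"
  proof
    fix y assume "y \<in> ball \<xi> \<rho>"
    then have y: "norm (\<xi> - y) < \<rho>" by (simp add: dist_norm)
    have n\<xi>: "norm \<xi> = 1" using \<xi> by simp
    have ny: "\<bar>1 - norm y\<bar> < \<rho>" using norm_triangle_ineq3[of \<xi> y] y n\<xi> by simp
    then have y0: "norm y > 0" using \<rho> by linarith
    then have sy: "sgn y \<in> sphere 0 1" by (simp add: norm_sgn)
    have ysgn: "y = norm y *\<^sub>R sgn y" using y0 by (simp add: sgn_div_norm)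
    from net[OF sy] obtain t where t: "t \<in> T" "dist (sgn y) t \<le> L" by blast
    have "norm (y - sgn y) = norm ((norm y - 1) *\<^sub>R sgn y)"
      by (subst (1) ysgn) (simp only: scaleR_left_diff_distrib scaleR_one)
    then have ys: "norm (y - sgn y) = \<bar>norm y - 1\<bar>" using sy by simp
    \<comment> \<open>Two terms are below \<open>\<rho>\<close> and the last is at most
      \<open>L \<le> \<rho>\<close>, so \<open>t\<close> lies in the cap of radius
      \<open>4 * \<rho>\<close>.\<close>
    have "dist \<xi> t \<le> norm (\<xi> - y) + norm (y - sgn y) + dist (sgn y) t"
      unfolding dist_norm by norm
    then have tA: "t \<in> A" using t ys y ny L by (simp add: A_def)
    define j where "j = nat \<lfloor>(norm y - (1 - \<rho>)) / L\<rfloor>"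
    have nonneg: "0 \<le> (norm y - (1 - \<rho>)) / L" using ny L by simp
    have "(norm y - (1 - \<rho>)) / L \<le> 2 * \<rho> / L"
      using ny L by (intro divide_right_mono) linarith+
    then have "j \<le> J" unfolding j_def J_def by (intro nat_mono floor_mono)
    have "real j \<le> (norm y - (1 - \<rho>)) / L" "(norm y - (1 - \<rho>)) / L < real j + 1"
      using nonneg unfolding j_def by linarith+
    then have qj: "0 \<le> norm y - q j" "norm y - q j \<le> L"
      using L by (auto simp: q_def field_simps)
    have q0: "0 \<le> q j" using L \<rho> by (simp add: q_def)
    \<comment> \<open>Radial and angular errors are separated. The first is at most \<open>L\<close>
      because \<open>j\<close> is rounded down; the second is at most \<open>2 * L\<close> because
      \<open>q j \<le> norm y < 2\<close>.\<close>
    have "y - q j *\<^sub>R t = (norm y - q j) *\<^sub>R sgn y + q j *\<^sub>R (sgn y - t)"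
      by (subst (1) ysgn) (simp only: scaleR_left_diff_distrib scaleR_right_diff_distrib, simp)
    then have "norm (y - q j *\<^sub>R t) \<le> norm ((norm y - q j) *\<^sub>R sgn y) + norm (q j *\<^sub>R (sgn y - t))"
      by (simp only: norm_triangle_ineq)
    also have "\<dots> = (norm y - q j) + q j * norm (sgn y - t)"
      using sy qj q0 by simp
    also have "\<dots> \<le> L + 2 * L"
      using qj q0 t(2) ny \<rho> L by (intro add_mono mult_mono) (auto simp: dist_norm)
    finally have "y \<in> cball (q j *\<^sub>R t) (3 * L)" by (simp add: dist_norm norm_minus_commute)
    then show "y \<in> (\<Union>(t, j)\<in>A \<times> {..J}. cball (q j *\<^sub>R t) (3 * L))"
      using tA \<open>j \<le> J\<close> by blast
  qed
  have "V * \<rho> ^ N = measure lebesgue (ball \<xi> \<rho>)"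
    using L by (simp add: content_ball V_def N_def)
  also have "\<dots> \<le> measure lebesgue (\<Union>(t, j)\<in>A \<times> {..J}. cball (q j *\<^sub>R t) (3 * L))"
    using fin by (intro measure_mono_fmeasurable[OF cover]) (auto intro!: fmeasurable.finite_UN)
  also have "\<dots> \<le> (\<Sum>(t, j)\<in>A \<times> {..J}. measure lebesgue (cball (q j *\<^sub>R t) (3 * L)))"
    using measure_UNION_le[OF fin, of "\<lambda>(t, j). cball (q j *\<^sub>R t) (3 * L)" lebesgue]
    by (auto simp: case_prod_unfold)
  also have "\<dots> = V * (real (card A) * (real J + 1) * (3 * L) ^ N)"
    using L by (simp add: content_cball V_def N_def case_prod_unfold card_cartesian_product algebra_simps)
  finally have 1: "\<rho> ^ N \<le> real (card A) * (real J + 1) * (3 * L) ^ N" using V by simp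
  \<comment> \<open>Since \<open>L \<le> \<rho>\<close>, the \<open>+ 1\<close> is absorbed and the
    number of spheres is of order \<open>\<rho> / L\<close>. This trades one factor \<open>L\<close>
    for a factor \<open>\<rho>\<close>, and cancelling \<open>\<rho>\<close> leaves the exponent
    \<open>N - 1\<close> on both sides.\<close>
  have "real J \<le> 2 * \<rho> / L" unfolding J_def using L by simp
  moreover have "1 \<le> \<rho> / L" using L by simp
  ultimately have "real J + 1 \<le> 3 * \<rho> / L" by simp
  then have "real (card A) * (real J + 1) * (3 * L) ^ N \<le> real (card A) * (3 * \<rho> / L) * (3 * L) ^ N"
    using L by (intro mult_right_mono mult_left_mono) auto
  also have "\<dots> = \<rho> * (3 ^ (N + 1) * real (card A) * L ^ (N - 1))"
    using L pow[of L] by (simp add: power_mult_distrib)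
  finally have "\<rho> * \<rho> ^ (N - 1) \<le> \<rho> * (3 ^ (N + 1) * real (card A) * L ^ (N - 1))"
    using 1 pow[of \<rho>] by linarith
  then show ?thesis using L by (simp add: N_def A_def)
qed

section \<open>Net radius and separation of the directions\<close>

text \<open>The sphere is connected in dimension at least 2, so if finite it would be a single
  point, yet it contains both \<open>e\<close> and \<open>- e\<close>.\<close>

lemma infinite_unit_sphere:
  assumes "DIM('a::euclidean_space) \<ge> 2"
  shows "infinite (sphere (0::'a) 1)"
proof
  assume fin: "finite (sphere (0::'a) 1)"
  obtain e :: 'a where e: "norm e = 1" using vector_choose_size[of 1] by auto
  have "e \<in> sphere 0 1" using e by simp
  then obtain b where b: "sphere (0::'a) 1 = {b}"
    using fin connected_finite_iff_sing[OF connected_sphere[OF assms]] by blast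
  have "e \<in> {b}" "- e \<in> {b}" unfolding b[symmetric] using e by simp_all
  then have "e - (- e) = 0" by (simp only: singleton_iff diff_self)
  then have "2 *\<^sub>R e = 0" by (simp only: diff_minus_eq_add scaleR_2)
  then show False using e by simp
qed

text \<open>The distances to a nearest direction are bounded by 2, so their supremum really is an
  upper bound, and each minimum over the finitely many indices is attained.\<close>

lemma Lambda_max_net:
  assumes "k \<ge> 1" "\<theta> \<in> sphere 0 1"
  shows "\<exists>i\<in>{1..k}. norm (\<theta> - sgn (x i)) \<le> Lambda_max k x"
proof -
  have fin: "finite {norm (\<theta> - sgn (x i)) |i. i \<in> {1..k}}" for \<theta> by simp
  have ne: "{norm (\<theta> - sgn (x i)) |i. i \<in> {1..k}} \<noteq> {}" for \<theta> using assms(1) by auto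
  have bdd: "bdd_above ((\<lambda>\<theta>. Min {norm (\<theta> - sgn (x i)) |i. i \<in> {1..k}}) ` sphere 0 1)"
  proof (rule bdd_aboveI2)
    fix \<theta> :: 'a assume \<theta>: "\<theta> \<in> sphere 0 1"
    have "Min {norm (\<theta> - sgn (x i)) |i. i \<in> {1..k}} \<le> norm (\<theta> - sgn (x 1))"
      using assms(1) by (intro Min_le fin) auto
    also have "\<dots> \<le> norm \<theta> + norm (sgn (x 1))" by (rule norm_triangle_ineq4)
    also have "\<dots> \<le> 2" using \<theta> by (simp add: norm_sgn)
    finally show "Min {norm (\<theta> - sgn (x i)) |i. i \<in> {1..k}} \<le> 2" .
  qed
  have "Min {norm (\<theta> - sgn (x i)) |i. i \<in> {1..k}} \<le> Lambda_max k x"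
    unfolding Lambda_max_def by (rule cSUP_upper[OF assms(2) bdd])
  moreover have "Min {norm (\<theta> - sgn (x i)) |i. i \<in> {1..k}} \<in> {norm (\<theta> - sgn (x i)) |i. i \<in> {1..k}}"
    by (rule Min_in[OF fin ne])
  ultimately show ?thesis by (smt (verit, best) mem_Collect_eq)
qed

text \<open>Finitely many directions miss some point of the infinite sphere, and that point has
  positive distance to all of them. Positivity later makes the extended quotient infinite when
  \<open>Gamma_min\<close> vanishes.\<close>

lemma Lambda_max_pos:
  fixes x :: "nat \<Rightarrow> 'a::euclidean_space"
  assumes "DIM('a) \<ge> 2" "k \<ge> 1"
  shows "0 < Lambda_max k x"
proof -
  have "\<not> sphere 0 1 \<subseteq> (\<lambda>i. sgn (x i)) ` {1..k}"
    using infinite_unit_sphere[OF assms(1)] finite_subset by blast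
  then obtain \<theta> where \<theta>: "\<theta> \<in> sphere 0 1" "\<theta> \<notin> (\<lambda>i. sgn (x i)) ` {1..k}" by blast
  obtain i where i: "i \<in> {1..k}" "norm (\<theta> - sgn (x i)) \<le> Lambda_max k x"
    using Lambda_max_net[OF assms(2) \<theta>(1)] by blast
  have "norm (\<theta> - sgn (x i)) > 0" using \<theta>(2) i(1) by auto
  then show ?thesis using i(2) by linarith
qed

lemma finite_direction_distances:
  fixes x :: "nat \<Rightarrow> 'a::euclidean_space"
  shows "finite {norm (sgn (x i) - sgn (x j)) |i j. i \<in> {1..k} \<and> j \<in> {1..k} \<and> i \<noteq> j}"
proof (rule finite_subset)
  show "finite {norm (sgn (x i) - sgn (x j)) |i j. i \<in> {1..k} \<and> j \<in> {1..k}}"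
    by (rule finite_image_set2) simp_all
qed (rule Collect_mono, iprover)

lemma Gamma_min_le:
  assumes "i \<in> {1..k}" "j \<in> {1..k}" "i \<noteq> j"
  shows "Gamma_min k x \<le> norm (sgn (x i) - sgn (x j))"
  unfolding Gamma_min_def using assms by (intro Min_le finite_direction_distances) auto

lemma Gamma_min_nonneg:
  assumes "k \<ge> 2"
  shows "0 \<le> Gamma_min k x"
proof -
  \<comment> \<open>Two distinct indices make the set nonempty, so that its \<open>Min\<close> is
    meaningful.\<close>
  have "norm (sgn (x 1) - sgn (x 2)) \<in> {norm (sgn (x i) - sgn (x j)) |i j. i \<in> {1..k} \<and> j \<in> {1..k} \<and> i \<noteq> j}"
    using assms by (intro CollectI exI[of _ 1] exI[of _ 2]) auto
  then show ?thesis
    unfolding Gamma_min_def by (subst Min_ge_iff[OF finite_direction_distances]) auto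
qed

lemma inj_on_directions:
  fixes x :: "nat \<Rightarrow> 'a::euclidean_space"
  assumes "Gamma_min k x > 0"
  shows "inj_on (\<lambda>i. sgn (x i)) {1..k}"
proof (rule inj_onI, rule ccontr)
  fix i j assume "i \<in> {1..k}" "j \<in> {1..k}" "sgn (x i) = sgn (x j)" "i \<noteq> j"
  then show False using Gamma_min_le[of i k j x] assms by simp
qed

section \<open>Counting bounds for one configuration\<close>

text \<open>Positive separation makes the directions distinct, so there are exactly \<open>k\<close>
  of them and the packing bound applies with \<open>d = Gamma_min k x\<close>, which is at most 2
  for unit vectors.\<close>

lemma Gamma_min_packing:
  fixes x :: "nat \<Rightarrow> 'a::euclidean_space"
  assumes k: "k \<ge> 2" and unit: "\<And>i. i \<in> {1..k} \<Longrightarrow> norm (sgn (x i)) = 1"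
    and pos: "Gamma_min k x > 0"
  shows "real k * Gamma_min k x ^ (DIM('a) - 1) \<le> real DIM('a) * 4 ^ DIM('a)"
proof -
  have "Gamma_min k x \<le> norm (sgn (x 1) - sgn (x 2))" using k by (intro Gamma_min_le) auto
  also have "\<dots> \<le> norm (sgn (x 1)) + norm (sgn (x 2))" by (rule norm_triangle_ineq4)
  finally have "Gamma_min k x \<le> 2" using k by (simp add: unit)
  then have "real (card ((\<lambda>i. sgn (x i)) ` {1..k})) * Gamma_min k x ^ (DIM('a) - 1)
      \<le> real DIM('a) * 4 ^ DIM('a)"
    using pos unit by (intro card_separated_sphere_le) (auto simp: dist_norm intro!: Gamma_min_le)
  then show ?thesis using card_image[OF inj_on_directions[OF pos]] by simp
qed

text \<open>The cap estimate with \<open>\<rho> = \<epsilon> / 4\<close> counts directions, whereas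
  \<open>N_count\<close> counts points. As \<open>sgn\<close> maps the counted points onto the
  directions in the cap, there are at least as many points.\<close>

lemma N_count_covering:
  fixes x :: "nat \<Rightarrow> 'a::euclidean_space"
  assumes k: "k \<ge> 1" and unit: "\<And>i. i \<in> {1..k} \<Longrightarrow> norm (sgn (x i)) = 1"
    and L: "0 < Lambda_max k x" "Lambda_max k x \<le> \<epsilon> / 4" and \<epsilon>: "\<epsilon> < 4"
    and \<xi>: "\<xi> \<in> sphere 0 1"
  shows "(\<epsilon> / 4) ^ (DIM('a) - 1)
    \<le> 3 ^ (DIM('a) + 1) * real (N_count k x \<xi> \<epsilon>) * Lambda_max k x ^ (DIM('a) - 1)"
proof -
  let ?T = "(\<lambda>i. sgn (x i)) ` {1..k}"
  have "?T \<inter> ball \<xi> (4 * (\<epsilon> / 4)) = sgn ` {x i |i. i \<in> {1..k} \<and> sgn (x i) \<in> ball \<xi> \<epsilon>}"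
    by (simp only: times_divide_eq_right nonzero_mult_div_cancel_left[OF zero_neq_numeral[symmetric]]) blast
  then have card: "card (?T \<inter> ball \<xi> (4 * (\<epsilon> / 4))) \<le> N_count k x \<xi> \<epsilon>"
    unfolding N_count_def by (simp add: card_image_le)
  have "(\<epsilon> / 4) ^ (DIM('a) - 1) \<le> 3 ^ (DIM('a) + 1)
      * real (card (?T \<inter> ball \<xi> (4 * (\<epsilon> / 4)))) * Lambda_max k x ^ (DIM('a) - 1)"
  proof (rule card_net_cap_ge)
    fix \<theta> :: 'a assume "\<theta> \<in> sphere 0 1"
    then show "\<exists>t\<in>?T. dist \<theta> t \<le> Lambda_max k x"
      using Lambda_max_net[OF k, of \<theta> x] by (auto simp: dist_norm)
  qed (use unit L \<epsilon> \<xi> in auto)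
  also have "\<dots> \<le> 3 ^ (DIM('a) + 1) * real (N_count k x \<xi> \<epsilon>) * Lambda_max k x ^ (DIM('a) - 1)"
    using card L by (intro mult_right_mono mult_left_mono) auto
  finally show ?thesis .
qed

text \<open>Covering bounds the count below by a multiple of
  \<open>(\<epsilon> / Lambda_max k x) ^ (DIM('a) - 1)\<close>. Comparison with
  \<open>Gamma_min\<close> and the packing bound turn this into a multiple of
  \<open>k * \<epsilon> ^ (DIM('a) - 1)\<close>, with a constant depending only on \<open>C\<close>
  and the dimension.\<close>

lemma N_count_density:
  fixes x :: "nat \<Rightarrow> 'a::euclidean_space" and C \<epsilon> :: real
  assumes k: "k \<ge> 2" and unit: "\<And>i. i \<in> {1..k} \<Longrightarrow> norm (sgn (x i)) = 1"
    and L: "0 < Lambda_max k x" "Lambda_max k x \<le> C * Gamma_min k x" "Lambda_max k x \<le> \<epsilon> / 4"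
    and pos: "0 < Gamma_min k x" "0 < C" "\<epsilon> < 4" and \<xi>: "\<xi> \<in> sphere 0 1"
  shows "1 / (3 ^ (DIM('a) + 1) * (4 * C) ^ (DIM('a) - 1) * (real DIM('a) * 4 ^ DIM('a)))
    \<le> real (N_count k x \<xi> \<epsilon>) / (real k * \<epsilon> ^ (DIM('a) - 1))"
proof -
  define N where "N = DIM('a)"
  define m where "m = real (N_count k x \<xi> \<epsilon>)"
  have N: "N \<ge> 1" unfolding N_def by simp
  have \<epsilon>: "\<epsilon> > 0" using L by simp
  have "(\<epsilon> / 4) ^ (N - 1) \<le> 3 ^ (N + 1) * m * Lambda_max k x ^ (N - 1)"
    unfolding N_def m_def using k unit L pos \<xi> by (intro N_count_covering) auto
  also have "\<dots> \<le> 3 ^ (N + 1) * m * (C * Gamma_min k x) ^ (N - 1)"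
    using L by (intro mult_left_mono power_mono) (auto simp: m_def)
  finally have "real k * (\<epsilon> / 4) ^ (N - 1) \<le> real k * (3 ^ (N + 1) * m * (C * Gamma_min k x) ^ (N - 1))"
    by (rule mult_left_mono) simp
  also have "\<dots> = 3 ^ (N + 1) * m * C ^ (N - 1) * (real k * Gamma_min k x ^ (N - 1))"
    by (simp add: power_mult_distrib)
  also have "\<dots> \<le> 3 ^ (N + 1) * m * C ^ (N - 1) * (real N * 4 ^ N)"
    using Gamma_min_packing[OF k unit pos(1)] pos
    by (intro mult_left_mono) (auto simp: m_def N_def)
  finally have "real k * \<epsilon> ^ (N - 1) \<le> m * (3 ^ (N + 1) * (4 * C) ^ (N - 1) * (real N * 4 ^ N))"
    by (simp add: power_divide power_mult_distrib field_simps)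
  moreover have "0 < real k * \<epsilon> ^ (N - 1)" "0 < 3 ^ (N + 1) * (4 * C) ^ (N - 1) * (real N * 4 ^ N)"
    using k pos \<epsilon> N by auto
  ultimately show ?thesis
    unfolding m_def[symmetric] N_def[symmetric] by (simp add: divide_le_eq le_divide_eq mult.commute)
qed

section \<open>Limits as the number of points grows\<close>

theorem corollary4p3:
  fixes a w :: "real ^ 'n \<Rightarrow> real"
    and p a_inf \<delta> R \<sigma>' \<sigma> :: real
    and r :: "real \<Rightarrow> nat \<Rightarrow> real"
    and x :: "real \<Rightarrow> nat \<Rightarrow> nat \<Rightarrow> real ^ 'n"
  assumes dim: "CARD('n) \<ge> 2"
    and p_gt: "p > 1"
    and p_subcritical: "CARD('n) \<ge> 3 \<Longrightarrow> p < (real CARD('n) + 2) / (real CARD('n) - 2)"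
    and a_loc: "a \<in> Lp_loc (real CARD('n) / 2)"
    and a_bdd: "bdd_below (range a)"
    and a_inf_pos: "(INF y. a y) > 0"
    and a_lim: "(a \<longlongrightarrow> a_inf) at_infinity"
    and a_decay: "\<And>\<eta>. \<eta> > 0 \<Longrightarrow>
          filterlim (\<lambda>y. (a y - a_inf) * exp (\<eta> * norm y)) at_top at_infinity"
    and a_osc: "\<exists>\<eta>'>0. ((\<lambda>\<rho>. (SUP (s, t) \<in> sphere 0 1 \<times> sphere 0 1. a (\<rho> *\<^sub>R s) - a (\<rho> *\<^sub>R t))
          * exp (\<eta>' * \<rho>)) \<longlongrightarrow> 0) at_top"
    and w: "radial_ground_state a_inf p w"
    and \<delta>_pos: "\<delta> > 0"
    and \<delta>_less: "\<delta> < Min {1, ((INF y. a y) / p) powr (1/(p-1)), ((INF y. a y) / 2) powr (1/(p-1)),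
          1/2 * (INF y. a y) powr (1/(p-1)), w 0 / 3}"
    and R_pos: "R > 0"
    and R: "\<And>y. y \<notin> ball 0 (R/2) \<Longrightarrow> w y < \<delta>"
    and rx: "\<And>s k. s > 0 \<Longrightarrow> k \<ge> 2 \<Longrightarrow> max_conf a p \<delta> R k s (r s k) (x s k)"
    and \<sigma>'_pos: "\<sigma>' > 0"
    \<comment> \<open>extended reals: the quotient is infinite when two directions coincide\<close>
    and \<sigma>': "\<And>s. s \<in> {0<..<\<sigma>'} \<Longrightarrow>
          limsup (\<lambda>k. ereal (Lambda_max k (x s k)) / ereal (Gamma_min k (x s k))) < \<infinity>"
    and \<sigma>: "\<sigma> \<in> {0<..<\<sigma>'}"
  shows "((\<lambda>k. Lambda_max k (x \<sigma> k)) \<longlonglongrightarrow> 0) \<and>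
         (\<exists>c>0. \<forall>\<xi>\<in>sphere 0 1.
            Liminf (at_right 0) (\<lambda>\<epsilon>. liminf (\<lambda>k.
              ereal (real (N_count k (x \<sigma> k) \<xi> \<epsilon>) / (real k * \<epsilon> ^ (CARD('n) - 1))))) \<ge> ereal c)"
proof -
  define X where "X = x \<sigma>"
  define \<Gamma> where "\<Gamma> = (\<lambda>k. Gamma_min k (X k))"
  define \<Lambda> where "\<Lambda> = (\<lambda>k. Lambda_max k (X k))"
  define N where "N = CARD('n)"
  have N: "DIM(real ^ 'n) = N" "N \<ge> 2" using dim by (simp_all add: N_def)
  \<comment> \<open>Membership in \<open>D_param\<close> puts the directions on the unit sphere and
    so excludes \<open>X k i = 0\<close>.\<close>
  have unit: "norm (sgn (X k i)) = 1" if "k \<ge> 2" "i \<in> {1..k}" for k i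
    using rx[of \<sigma> k] \<sigma> that by (auto simp: max_conf_def D_param_def X_def)
  have \<Lambda>pos: "\<Lambda> k > 0" if "k \<ge> 2" for k
    unfolding \<Lambda>_def using that N by (intro Lambda_max_pos) auto
  obtain n :: nat where n: "limsup (\<lambda>k. ereal (\<Lambda> k) / ereal (\<Gamma> k)) < ereal (real n)"
    using \<sigma>'[OF \<sigma>] unfolding \<Lambda>_def \<Gamma>_def X_def less_PInf_Ex_of_nat[symmetric]
    by (metis less_PInf_Ex_of_nat less_irrefl)
  \<comment> \<open>Adding 1 makes \<open>C\<close> positive whatever \<open>n\<close> is.\<close>
  define C where "C = real n + 1"
  have C: "C > 0" by (simp add: C_def)
  have bound: "\<forall>\<^sub>F k in sequentially. 2 \<le> k \<and> 0 < \<Gamma> k \<and> \<Lambda> k \<le> C * \<Gamma> k"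
    using Limsup_lessD[OF n] eventually_ge_at_top[of 2]
  proof eventually_elim
    case (elim k)
    \<comment> \<open>Division of the positive \<open>\<Lambda> k\<close> by 0 gives infinity in the
      extended reals, contradicting the bound by \<open>n\<close>.\<close>
    have "\<Gamma> k \<noteq> 0" using elim \<Lambda>pos[of k] by auto
    then have pos: "0 < \<Gamma> k" using Gamma_min_nonneg[OF elim(2), of "X k"] by (simp add: \<Gamma>_def)
    then have "\<Lambda> k < real n * \<Gamma> k" using elim(1) by (simp add: field_simps)
    also have "\<dots> \<le> C * \<Gamma> k" using pos by (simp add: C_def)
    finally show ?case using elim(2) pos by simp
  qed
  define K where "K = real N * 4 ^ N"
  \<comment> \<open>Packing controls only the power \<open>N - 1\<close> of
    \<open>\<Gamma> k\<close>, so the limit is taken for that power first; \<open>N \<ge> 2\<close>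
    makes the exponent positive, and the root can be extracted.\<close>
  have "(\<lambda>k. \<Lambda> k ^ (N - 1)) \<longlonglongrightarrow> 0"
  proof (rule tendsto_sandwich)
    show "\<forall>\<^sub>F k in sequentially. \<Lambda> k ^ (N - 1) \<le> C ^ (N - 1) * K / real k"
      using bound
    proof eventually_elim
      case (elim k)
      have "real k * \<Gamma> k ^ (N - 1) \<le> K"
        using Gamma_min_packing[of k "X k"] elim unit N by (simp add: \<Gamma>_def K_def)
      then have "\<Gamma> k ^ (N - 1) \<le> K / real k" using elim by (simp add: field_simps)
      then have "C ^ (N - 1) * \<Gamma> k ^ (N - 1) \<le> C ^ (N - 1) * (K / real k)"
        using C by (intro mult_left_mono) auto
      moreover have "\<Lambda> k ^ (N - 1) \<le> (C * \<Gamma> k) ^ (N - 1)"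
        using elim \<Lambda>pos[of k] by (intro power_mono) auto
      ultimately show ?case by (simp add: power_mult_distrib)
    qed
    show "\<forall>\<^sub>F k in sequentially. 0 \<le> \<Lambda> k ^ (N - 1)"
      using eventually_ge_at_top[of 2] by eventually_elim (use \<Lambda>pos in \<open>simp add: less_imp_le\<close>)
    show "(\<lambda>k. C ^ (N - 1) * K / real k) \<longlonglongrightarrow> 0"
      by (rule real_tendsto_divide_at_top[OF tendsto_const filterlim_real_sequentially])
  qed simp
  then have \<Lambda>lim: "\<Lambda> \<longlonglongrightarrow> 0" using N by (subst (asm) power_tendsto_0_iff) auto
  \<comment> \<open>This is the constant of \<open>N_count_density\<close>; it is independent of
    \<open>\<xi>\<close> and \<open>\<epsilon>\<close>, hence uniform over the sphere.\<close>
  define c where "c = 1 / (3 ^ (N + 1) * (4 * C) ^ (N - 1) * K)"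
  have c: "c > 0" using C N by (simp add: c_def K_def)
  have "ereal c \<le> Liminf (at_right 0) (\<lambda>\<epsilon>. liminf (\<lambda>k.
      ereal (real (N_count k (X k) \<xi> \<epsilon>) / (real k * \<epsilon> ^ (N - 1)))))" if \<xi>: "\<xi> \<in> sphere 0 1" for \<xi>
  proof (rule Liminf_bounded)
    \<comment> \<open>The restriction \<open>\<epsilon> < 4\<close> keeps the radius
      \<open>\<epsilon> / 4\<close> below 1, as the cap estimate requires. With
      \<open>\<epsilon>\<close> fixed, \<open>\<Lambda> k\<close> drops below
      \<open>\<epsilon> / 4\<close> for all large \<open>k\<close>.\<close>
    have "\<forall>\<^sub>F \<epsilon> in at_right (0::real). \<epsilon> \<in> {0<..<4}" by (rule eventually_at_right_real) simp
    then show "\<forall>\<^sub>F \<epsilon> in at_right 0. ereal c \<le> liminf (\<lambda>k.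
        ereal (real (N_count k (X k) \<xi> \<epsilon>) / (real k * \<epsilon> ^ (N - 1))))"
    proof eventually_elim
      case (elim \<epsilon>)
      then have "\<forall>\<^sub>F k in sequentially. \<Lambda> k < \<epsilon> / 4"
        using order_tendstoD(2)[OF \<Lambda>lim, of "\<epsilon> / 4"] by simp
      with bound have "\<forall>\<^sub>F k in sequentially.
          c \<le> real (N_count k (X k) \<xi> \<epsilon>) / (real k * \<epsilon> ^ (N - 1))"
      proof eventually_elim
        case (elim k)
        show ?case
          using N_count_density[of k "X k" C \<epsilon> \<xi>] elim \<open>\<epsilon> \<in> {0<..<4}\<close> unit \<Lambda>pos C \<xi> N
          by (simp add: \<Gamma>_def \<Lambda>_def c_def K_def)
      qed
      then show ?case by (intro Liminf_bounded) simp
    qed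
  qed
  then show ?thesis using \<Lambda>lim c unfolding \<Lambda>_def X_def N_def by blast
qed

end
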